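(* Let $d\ge1$ and let $c(i,j)$, $i,j\in\{1,\ldots,d\}$, be real numbers. Let $(\mathcal{A},\phi)$ be a probability space with expectation $\mathbb{E}$, with $\mathcal{A}$ generated by symmetric operators $X_1,\ldots,X_d$, such that for all $i,j\in\{1,\ldots,d\}$ \[ [a^-(i);a^+(j)]=c(i,j)\, I,\qquad [a^-(i);a^0(j)]=0,\qquad \mathbb{E}[X_i]=0, \] where $[A;B]=AB-BA$ and $a^-(i),a^0(i),a^+(i)$ are the annihilation, preservation and creation operators of $X_i$. Then for every $n\in\mathbb{N}$ and every $\sigma:\{1,\ldots,2n\}\to\{1,\ldots,d\}$ \[ \mathbb{E}[X_{\sigma(1)}\cdots X_{\sigma(2n)}]=\sum_{\gamma\in\mathsf{F}_c(\{1,\ldots,2n\})}\nu(\gamma), \] where $\nu(\gamma)=\prod_{(i,j)\in\gamma}c(\sigma(i),\sigma(j))$, and for every $\sigma:\{1,\ldots,2n+1\}\to\{1,\ldots,d\}$, $\mathbb{E}[X_{\sigma(1)}\cdots X_{\sigma(2n+1)}]=0$.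
   Context: **Probability spaces.** Let $(H,\langle\cdot,\cdot\rangle)$ be a real Hilbert space and $X_1,\ldots,X_d$ symmetric, densely defined linear operators on $H$. $\mathcal{A}$ is the unital algebra generated by $X_1,\ldots,X_d$ (containing the identity $I$). A unit vector $\phi\in H$ (the vacuum vector) lying in the domain of every $g\in\mathcal{A}$ is fixed. $(\mathcal{A},\phi)$ is called a probability space supported by $H$ and $\mathbb{E}[g]:=\langle g\phi,\phi\rangle$ for $g\in\mathcal{A}$. **Annihilation, preservation, creation operators.** For $n\ge 0$ let $F_n=\{p(X_1,\ldots,X_d)\phi: p \text{ a noncommutative polynomial of total degree}\le n\}$. Put $G_{-1}=\{0\}$, $G_0=F_0$, and for $n\ge1$ let $G_n$ be the orthogonal complement of $F_{n-1}$ in $F_n$. Then $\mathcal{A}\phi=\{g\phi:g\in\mathcal{A}\}$ is the algebraic direct sum of the $G_n$ and $X_iG_n\subset G_{n-1}\oplus G_n\oplus G_{n+1}$; $a^-(i),a^0(i),a^+(i)$ are the unique linear operators with domain $\mathcal{A}\phi$ with $X_i=a^-(i)+a^0(i)+a^+(i)$ on $\mathcal{A}\phi$, $a^-(i)(G_n)\subset G_{n-1}$, $a^0(i)(G_n)\subset G_n$, $a^+(i)(G_n)\subset G_{n+1}$ for all $n\ge0$. Operator identities are on $\mathcal{A}\phi$. **Feynman diagrams.** A complete Feynman diagram on $\{1,\ldots,2n\}$ is a partition $\gamma$ of $\{1,\ldots,2n\}$ into two-element sets, regarded as a set of ordered pairs $(i,j)$ with $i<j$; $\mathsf{F}_c(\{1,\ldots,2n\})$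 is the set of all of these. *)

theory Defs
  imports
    "HOL-Analysis.Analysis"
    "HOL-Library.Poly_Mapping"
    "HOL-Library.Disjoint_Sets"
begin

text \<open>A partially defined operator \<open>T\<close> on \<open>'h\<close> is a map whose domain is \<open>dom T\<close>.
  Sums, multiples and products (\<open>S \<circ>\<^sub>m T\<close>) carry their natural domains.\<close>

type_synonym 'h pop = "'h \<Rightarrow> 'h option"

definition pop_id :: "'h pop" where
  "pop_id v = Some v"

definition pop_add :: "'h::real_vector pop \<Rightarrow> 'h pop \<Rightarrow> 'h pop" where
  "pop_add S T v =
    (if v \<in> dom S \<inter> dom T then Some (the (S v) + the (T v)) else None)"

definition pop_scale :: "real \<Rightarrow> 'h::real_vector pop \<Rightarrow> 'h pop" where
  "pop_scale r T v = map_option (\<lambda>w. r *\<^sub>R w) (T v)"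

definition linear_pop :: "'h::real_vector pop \<Rightarrow> bool" where
  "linear_pop T \<longleftrightarrow> subspace (dom T) \<and>
    (\<forall>u\<in>dom T. \<forall>v\<in>dom T. the (T (u + v)) = the (T u) + the (T v)) \<and>
    (\<forall>r. \<forall>v\<in>dom T. the (T (r *\<^sub>R v)) = r *\<^sub>R the (T v))"

definition densely_defined :: "'h::topological_space pop \<Rightarrow> bool" where
  "densely_defined T \<longleftrightarrow> closure (dom T) = UNIV"

definition symmetric_pop :: "'h::real_inner pop \<Rightarrow> bool" where
  "symmetric_pop T \<longleftrightarrow>
    (\<forall>u\<in>dom T. \<forall>v\<in>dom T. inner (the (T u)) v = inner u (the (T v)))"

inductive_set gen_algebra :: "nat \<Rightarrow> (nat \<Rightarrow> 'h::real_vector pop) \<Rightarrow> 'h pop set"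
  for d :: nat and X :: "nat \<Rightarrow> 'h pop" where
  one: "pop_id \<in> gen_algebra d X"
| gen: "i \<in> {1..d} \<Longrightarrow> X i \<in> gen_algebra d X"
| add: "S \<in> gen_algebra d X \<Longrightarrow> T \<in> gen_algebra d X \<Longrightarrow> pop_add S T \<in> gen_algebra d X"
| scale: "T \<in> gen_algebra d X \<Longrightarrow> pop_scale r T \<in> gen_algebra d X"
| mult: "S \<in> gen_algebra d X \<Longrightarrow> T \<in> gen_algebra d X \<Longrightarrow> S \<circ>\<^sub>m T \<in> gen_algebra d X"

definition probability_space ::
    "nat \<Rightarrow> (nat \<Rightarrow> 'h::{real_inner, complete_space} pop) \<Rightarrow> 'h \<Rightarrow> bool" where
  "probability_space d X \<phi> \<longleftrightarrow>
    (\<forall>i\<in>{1..d}. linear_pop (X i) \<and> densely_defined (X i) \<and> symmetric_pop (X i)) \<and>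
    norm \<phi> = 1 \<and>
    (\<forall>g\<in>gen_algebra d X. \<phi> \<in> dom g)"

definition expectation :: "'h::real_inner \<Rightarrow> 'h pop \<Rightarrow> real" where
  "expectation \<phi> g = inner (the (g \<phi>)) \<phi>"

definition vacuum_orbit :: "nat \<Rightarrow> (nat \<Rightarrow> 'h::real_vector pop) \<Rightarrow> 'h \<Rightarrow> 'h set" where
  "vacuum_orbit d X \<phi> = {the (g \<phi>) | g. g \<in> gen_algebra d X}"

text \<open>The word \<open>[i\<^sub>1, \<dots>, i\<^sub>k]\<close> stands for the product of \<open>X i\<^sub>1, \<dots>, X i\<^sub>k\<close> in this order, so
  \<open>X i\<^sub>k\<close> is applied first.\<close>

primrec word_pop :: "(nat \<Rightarrow> 'h pop) \<Rightarrow> nat list \<Rightarrow> 'h pop" where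
  "word_pop X [] = pop_id"
| "word_pop X (i # w) = X i \<circ>\<^sub>m word_pop X w"

text \<open>Noncommutative polynomials in \<open>d\<close> indeterminates are finitely supported real functions on
  the words over \<open>{1..d}\<close>.\<close>

type_synonym ncpoly = "(nat list, real) poly_mapping"

definition ncpolys :: "nat \<Rightarrow> nat \<Rightarrow> ncpoly set" where
  "ncpolys d n = {p. \<forall>w\<in>Poly_Mapping.keys p. set w \<subseteq> {1..d} \<and> length w \<le> n}"

definition ncpoly_pop :: "(nat \<Rightarrow> 'h::real_vector pop) \<Rightarrow> ncpoly \<Rightarrow> 'h pop" where
  "ncpoly_pop X p v =
    (if \<forall>w\<in>Poly_Mapping.keys p. v \<in> dom (word_pop X w)
     then Some (\<Sum>w\<in>Poly_Mapping.keys p. Poly_Mapping.lookup p w *\<^sub>R the (word_pop X w v))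
     else None)"

definition F_space :: "nat \<Rightarrow> (nat \<Rightarrow> 'h::real_vector pop) \<Rightarrow> 'h \<Rightarrow> nat \<Rightarrow> 'h set" where
  "F_space d X \<phi> n = {the (ncpoly_pop X p \<phi>) | p. p \<in> ncpolys d n}"

text \<open>Indexed by integers because of \<open>G\<^sub>-\<^sub>1 = {0}\<close>; indices below \<open>-1\<close> are never used.\<close>

definition G_space :: "nat \<Rightarrow> (nat \<Rightarrow> 'h::real_inner pop) \<Rightarrow> 'h \<Rightarrow> int \<Rightarrow> 'h set" where
  "G_space d X \<phi> k =
    (if k < 0 then {0}
     else if k = 0 then F_space d X \<phi> 0
     else F_space d X \<phi> (nat k) \<inter> orthogonal_comp (F_space d X \<phi> (nat (k - 1))))"

definition linear_endo_on :: "'h::real_vector set \<Rightarrow> ('h \<Rightarrow> 'h) \<Rightarrow> bool" where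
  "linear_endo_on V f \<longleftrightarrow> f ` V \<subseteq> V \<and>
    (\<forall>u\<in>V. \<forall>v\<in>V. f (u + v) = f u + f v) \<and>
    (\<forall>r. \<forall>v\<in>V. f (r *\<^sub>R v) = r *\<^sub>R f v)"

text \<open>The annihilation, preservation and creation operators \<open>am i\<close>, \<open>a0 i\<close>, \<open>ap i\<close> have domain
  \<open>vacuum_orbit d X \<phi>\<close>; they are total functions here, whose values off that space are irrelevant.
  On it, the conditions below determine them uniquely.\<close>

definition ann_pres_cre_operators ::
    "nat \<Rightarrow> (nat \<Rightarrow> 'h::real_inner pop) \<Rightarrow> 'h \<Rightarrow>
     (nat \<Rightarrow> 'h \<Rightarrow> 'h) \<Rightarrow> (nat \<Rightarrow> 'h \<Rightarrow> 'h) \<Rightarrow> (nat \<Rightarrow> 'h \<Rightarrow> 'h) \<Rightarrow> bool" where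
  "ann_pres_cre_operators d X \<phi> am a0 ap \<longleftrightarrow>
    (\<forall>i\<in>{1..d}.
      linear_endo_on (vacuum_orbit d X \<phi>) (am i) \<and>
      linear_endo_on (vacuum_orbit d X \<phi>) (a0 i) \<and>
      linear_endo_on (vacuum_orbit d X \<phi>) (ap i) \<and>
      (\<forall>v\<in>vacuum_orbit d X \<phi>. X i v = Some (am i v + a0 i v + ap i v)) \<and>
      (\<forall>n::nat.
        am i ` G_space d X \<phi> (int n) \<subseteq> G_space d X \<phi> (int n - 1) \<and>
        a0 i ` G_space d X \<phi> (int n) \<subseteq> G_space d X \<phi> (int n) \<and>
        ap i ` G_space d X \<phi> (int n) \<subseteq> G_space d X \<phi> (int n + 1)))"

definition commutator :: "('h::real_vector \<Rightarrow> 'h) \<Rightarrow> ('h \<Rightarrow> 'h) \<Rightarrow> 'h \<Rightarrow> 'h" where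
  "commutator A B v = A (B v) - B (A v)"

definition complete_feynman :: "nat set \<Rightarrow> (nat \<times> nat) set set" where
  "complete_feynman A =
    {\<gamma>. (\<forall>(i, j)\<in>\<gamma>. i < j) \<and> partition_on A ((\<lambda>(i, j). {i, j}) ` \<gamma>)}"

definition feynman_weight ::
    "(nat \<Rightarrow> nat \<Rightarrow> real) \<Rightarrow> (nat \<Rightarrow> nat) \<Rightarrow> (nat \<times> nat) set \<Rightarrow> real" where
  "feynman_weight c \<sigma> \<gamma> = (\<Prod>(i, j)\<in>\<gamma>. c (\<sigma> i) (\<sigma> j))"

end

theory Submission
  imports Defs
begin

text \<open>Both sides of the moment formula obey the same recursion on the smallest position.

  On the operator side, \<open>X\<^sub>i v\<close> and \<open>a\<^sup>-(i) v\<close> have the same component along the vacuum: the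
  creation part of \<open>X\<^sub>i v\<close> is orthogonal to \<open>\<phi>\<close>, and so is the preservation part, because
  \<open>a\<^sup>0(i)\<close> preserves each \<open>G\<^sub>n\<close> and kills \<open>\<phi>\<close> (this is where \<open>E[X\<^sub>i] = 0\<close> enters). One can then
  move \<open>a\<^sup>-(i)\<close> through the remaining factors \<open>X\<^sub>j\<close> until it reaches \<open>\<phi>\<close> and annihilates it. Since
  \<open>[a\<^sup>-(i), X\<^sub>j] = c(i, j) I\<close>, passing \<open>X\<^sub>j\<close> leaves the word with that factor deleted, weighted by
  \<open>c(i, j)\<close> (\<open>am_field_word\<close>), so
  \<open>E[X\<^sub>i X\<^sub>j\<^sub>1 \<dots> X\<^sub>j\<^sub>k] = \<Sum>\<^sub>l c(i, j\<^sub>l) E[X\<^sub>j\<^sub>1 \<dots> X\<^sub>j\<^sub>k without X\<^sub>j\<^sub>l]\<close>.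

  The relation \<open>[a\<^sup>-(i), X\<^sub>j] = c(i, j) I\<close> also requires that annihilation operators commute with each
  other, which is not among the hypotheses. It is derived in \<open>am_commute\<close>: by the Jacobi identity,
  \<open>[a\<^sup>-(i), a\<^sup>-(j)]\<close> commutes with every creation and preservation operator, and it kills \<open>\<phi>\<close>;
  hence it vanishes on everything that these operators produce from \<open>\<phi>\<close>. The span of the vectors
  so produced is invariant under the annihilation operators too, so it contains all \<open>X\<close>-words
  applied to \<open>\<phi>\<close>, and the whole argument takes place inside it.

  On the combinatorial side, the smallest position is paired with some \<open>j\<close>, and deleting this pair
  leaves an arbitrary complete diagram on the other positions (\<open>feynman_sum_recursion\<close>). For the
  induction to apply after such deletions, both recursions are stated for words and diagrams
  indexed by an arbitrary finite set of positions. The odd moments are sums over no diagrams,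
  hence zero.\<close>

section \<open>Linear maps on an invariant subspace\<close>

lemma linear_endo_onD:
  assumes "linear_endo_on V f"
  shows linear_endo_on_closed: "v \<in> V \<Longrightarrow> f v \<in> V"
    and linear_endo_on_add: "u \<in> V \<Longrightarrow> v \<in> V \<Longrightarrow> f (u + v) = f u + f v"
    and linear_endo_on_scale: "v \<in> V \<Longrightarrow> f (r *\<^sub>R v) = r *\<^sub>R f v"
  using assms unfolding linear_endo_on_def by auto

lemma linear_endo_on_zero:
  assumes "linear_endo_on V f" "subspace V"
  shows "f 0 = 0"
  using linear_endo_on_scale[OF assms(1), of 0 0] subspace_0[OF assms(2)] by simp

lemma linear_endo_on_sum:
  assumes "linear_endo_on V f" "subspace V" "\<And>x. x \<in> A \<Longrightarrow> g x \<in> V"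
  shows "f (\<Sum>x\<in>A. g x) = (\<Sum>x\<in>A. f (g x))"
  using assms(3)
proof (induction A rule: infinite_finite_induct)
  case (insert x A)
  then show ?case
    using linear_endo_on_add[OF assms(1), of "g x" "\<Sum>x\<in>A. g x"] subspace_sum[OF assms(2), of A g]
    by simp
qed (auto simp: linear_endo_on_zero[OF assms(1,2)])

lemma linear_endo_on_commutator:
  assumes f: "linear_endo_on V f" and g: "linear_endo_on V g" and V: "subspace V"
  shows "linear_endo_on V (commutator f g)"
  unfolding linear_endo_on_def commutator_def
  using linear_endo_onD[OF f] linear_endo_onD[OF g] subspace_diff[OF V]
  by (auto simp: algebra_simps)

lemma linear_endo_on_maps_span:
  assumes f: "linear_endo_on V f" and V: "subspace V" and S: "subspace S"
    and M: "M \<subseteq> V" "f ` M \<subseteq> S"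
  shows "f ` span M \<subseteq> S"
proof -
  have "subspace {v \<in> V. f v \<in> S}"
    using linear_endo_onD[OF f] linear_endo_on_zero[OF f V] V S
    by (auto simp: subspace_def)
  moreover have "M \<subseteq> {v \<in> V. f v \<in> S}"
    using M by auto
  ultimately have "span M \<subseteq> {v \<in> V. f v \<in> S}"
    by (rule span_minimal[rotated])
  then show ?thesis by auto
qed

section \<open>Commutation relations on a cyclic space\<close>

text \<open>What the argument uses of the annihilation, preservation and creation operators, for an
  arbitrary invariant subspace \<open>V\<close>. The grading \<open>G\<close> serves to separate vectors with a vacuum component
  from those without one; its levels need not be orthogonal to each other.\<close>

locale fock_operators =
  fixes I :: "nat set" and V :: "'h::real_inner set" and \<phi> :: 'h
    and c :: "nat \<Rightarrow> nat \<Rightarrow> real"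
    and am a0 ap :: "nat \<Rightarrow> 'h \<Rightarrow> 'h"
    and G :: "nat \<Rightarrow> 'h set"
  assumes V: "subspace V" and vacuum_in_V: "\<phi> \<in> V"
    and am: "i \<in> I \<Longrightarrow> linear_endo_on V (am i)"
    and a0: "i \<in> I \<Longrightarrow> linear_endo_on V (a0 i)"
    and ap: "i \<in> I \<Longrightarrow> linear_endo_on V (ap i)"
    and am_ap: "i \<in> I \<Longrightarrow> j \<in> I \<Longrightarrow> v \<in> V \<Longrightarrow> commutator (am i) (ap j) v = c i j *\<^sub>R v"
    and am_a0: "i \<in> I \<Longrightarrow> j \<in> I \<Longrightarrow> v \<in> V \<Longrightarrow> commutator (am i) (a0 j) v = 0"
    and am_vacuum: "i \<in> I \<Longrightarrow> am i \<phi> = 0"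
    and a0_vacuum: "i \<in> I \<Longrightarrow> a0 i \<phi> = 0"
    and G_vacuum: "\<phi> \<in> G 0" and G_0: "G 0 \<subseteq> span {\<phi>}"
    and G_Suc: "G (Suc n) \<subseteq> orthogonal_comp {\<phi>}"
    and G_a0: "i \<in> I \<Longrightarrow> a0 i ` G n \<subseteq> G n"
    and G_ap: "i \<in> I \<Longrightarrow> ap i ` G n \<subseteq> G (Suc n)"
begin

text \<open>Annihilation operators are left out on purpose: a commutator of two of them kills the vacuum and
  commutes with creation and preservation operators, so it can be shown to vanish on these
  monomials by induction, but nothing is known yet about its commutator with a third one.\<close>

inductive_set monomials :: "'h set" where
  vacuum: "\<phi> \<in> monomials"
| creation: "u \<in> monomials \<Longrightarrow> i \<in> I \<Longrightarrow> ap i u \<in> monomials"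
| preservation: "u \<in> monomials \<Longrightarrow> i \<in> I \<Longrightarrow> a0 i u \<in> monomials"

definition "field i v = am i v + a0 i v + ap i v"

abbreviation "field_word w \<equiv> foldr field w \<phi>"

lemma monomials_subset: "monomials \<subseteq> V"
proof
  fix u assume "u \<in> monomials"
  then show "u \<in> V"
    by induction (auto simp: vacuum_in_V intro: linear_endo_on_closed[OF ap] linear_endo_on_closed[OF a0])
qed

lemma span_monomials_subset: "span monomials \<subseteq> V"
  using span_minimal[OF monomials_subset V] .

lemma monomial_graded:
  assumes "u \<in> monomials"
  obtains n where "u \<in> G n"
  using assms
proof (induction arbitrary: thesis)
  case vacuum
  show ?case by (rule vacuum(1)[OF G_vacuum])
next
  case (creation u i)
  from creation.IH obtain n where "u \<in> G n" by blast
  then have "ap i u \<in> G (Suc n)" using G_ap[OF creation(2), of n] by blast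
  then show ?case by (rule creation.prems)
next
  case (preservation u i)
  from preservation.IH obtain n where "u \<in> G n" by blast
  then have "a0 i u \<in> G n" using G_a0[OF preservation(2), of n] by blast
  then show ?case by (rule preservation.prems)
qed

lemma am_ap_eq:
  assumes "i \<in> I" "j \<in> I" "v \<in> V"
  shows "am i (ap j v) = ap j (am i v) + c i j *\<^sub>R v"
  using am_ap[OF assms] by (simp add: commutator_def algebra_simps)

lemma am_a0_eq:
  assumes "i \<in> I" "j \<in> I" "v \<in> V"
  shows "am i (a0 j v) = a0 j (am i v)"
  using am_a0[OF assms] by (simp add: commutator_def)

lemma span_monomials_ap:
  assumes "i \<in> I" "v \<in> span monomials" shows "ap i v \<in> span monomials"
  using linear_endo_on_maps_span[OF ap V subspace_span monomials_subset, of i monomials] assms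
  by (auto intro: span_base monomials.creation)

lemma span_monomials_a0:
  assumes "i \<in> I" "v \<in> span monomials" shows "a0 i v \<in> span monomials"
  using linear_endo_on_maps_span[OF a0 V subspace_span monomials_subset, of i monomials] assms
  by (auto intro: span_base monomials.preservation)

text \<open>An annihilation operator can be moved to the right through a monomial until it meets the
  vacuum; the scalar commutators that arise on the way leave combinations of monomials.\<close>

lemma span_monomials_am:
  assumes i: "i \<in> I" and v: "v \<in> span monomials" shows "am i v \<in> span monomials"
proof -
  have "am i u \<in> span monomials" if "u \<in> monomials" for u
    using that
  proof induction
    case vacuum
    show ?case by (simp add: am_vacuum[OF i] span_zero)
  next
    case (creation u j)
    have "u \<in> V" using creation(1) monomials_subset by blast
    then show ?case
      using creation span_monomials_ap
      by (simp add: am_ap_eq[OF i creation(2)] span_add span_base span_scale)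
  next
    case (preservation u j)
    have "u \<in> V" using preservation(1) monomials_subset by blast
    then show ?case
      using preservation span_monomials_a0 by (simp add: am_a0_eq[OF i preservation(2)])
  qed
  then have "am i ` span monomials \<subseteq> span monomials"
    by (intro linear_endo_on_maps_span[OF am[OF i] V subspace_span monomials_subset]) blast
  then show ?thesis using v by blast
qed

text \<open>By the Jacobi identity,
  \<open>[[a\<^sup>-(i), a\<^sup>-(j)], a\<^sup>+(k)] = [a\<^sup>-(i), [a\<^sup>-(j), a\<^sup>+(k)]] - [a\<^sup>-(j), [a\<^sup>-(i), a\<^sup>+(k)]] = 0\<close>,
  as the inner commutators are scalars; the same holds with \<open>a\<^sup>0(k)\<close> for \<open>a\<^sup>+(k)\<close>. So
  \<open>[a\<^sup>-(i), a\<^sup>-(j)]\<close> can be moved to the right through a monomial, down to the vacuum, which it kills.\<close>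

lemma am_commute:
  assumes i: "i \<in> I" and j: "j \<in> I" and v: "v \<in> span monomials"
  shows "am i (am j v) = am j (am i v)"
proof -
  note closed = linear_endo_on_closed[OF am]
  have "am i (am j u) = am j (am i u)" if "u \<in> monomials" for u
    using that
  proof induction
    case vacuum
    show ?case
      by (simp add: am_vacuum[OF i] am_vacuum[OF j] linear_endo_on_zero[OF am V] i j)
  next
    case (creation u k)
    have u: "u \<in> V" using creation(1) monomials_subset by blast
    \<comment> \<open>The inhomogeneous terms below are symmetric in \<open>p\<close> and \<open>q\<close>, so they cancel in the commutator.\<close>
    have *: "am p (am q (ap k u)) =
        ap k (am p (am q u)) + c p k *\<^sub>R am q u + c q k *\<^sub>R am p u"
      if p: "p \<in> I" and q: "q \<in> I" for p q
    proof -
      have "am p (am q (ap k u)) = am p (ap k (am q u)) + am p (c q k *\<^sub>R u)"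
        unfolding am_ap_eq[OF q creation(2) u]
        by (rule linear_endo_on_add[OF am[OF p]])
          (auto intro!: linear_endo_on_closed[OF ap] closed subspace_scale[OF V] u q creation(2))
      then show ?thesis
        by (simp add: am_ap_eq[OF p creation(2) closed[OF q u]]
            linear_endo_on_scale[OF am[OF p] u])
    qed
    show ?case
      by (simp add: *[OF i j] *[OF j i] creation.IH)
  next
    case (preservation u k)
    have u: "u \<in> V" using preservation(1) monomials_subset by blast
    show ?case
      using preservation.IH
      by (simp add: am_a0_eq[OF _ preservation(2)] closed i j u)
  qed
  then have "commutator (am i) (am j) ` span monomials \<subseteq> {0}"
    by (intro linear_endo_on_maps_span[OF linear_endo_on_commutator[OF am[OF i] am[OF j] V] V
          subspace_single_0 monomials_subset]) (auto simp: commutator_def)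
  then show ?thesis using v by (auto simp: commutator_def)
qed

text \<open>The creation and preservation parts have no vacuum component. On a monomial of positive degree
  this is because both keep the degree positive; in degree \<open>0\<close> the creation operator raises the
  degree and the preservation operator kills multiples of the vacuum.\<close>

lemma inner_field_vacuum:
  assumes i: "i \<in> I" and v: "v \<in> span monomials"
  shows "inner (field i v) \<phi> = inner (am i v) \<phi>"
proof -
  have ap_orth: "ap i u \<in> orthogonal_comp {\<phi>}"
    and a0_orth: "a0 i u \<in> orthogonal_comp {\<phi>}" if u: "u \<in> monomials" for u
  proof -
    obtain n where n: "u \<in> G n" using monomial_graded[OF u] .
    then show "ap i u \<in> orthogonal_comp {\<phi>}"
      using G_ap[OF i, of n] G_Suc[of n] by blast
    show "a0 i u \<in> orthogonal_comp {\<phi>}"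
    proof (cases n)
      case 0
      then obtain r where "u = r *\<^sub>R \<phi>"
        using n G_0 by (auto simp: span_singleton)
      then have "a0 i u = 0"
        by (simp add: linear_endo_on_scale[OF a0[OF i] vacuum_in_V] a0_vacuum[OF i])
      then show ?thesis by (simp add: subspace_0[OF subspace_orthogonal_comp])
    next
      case (Suc m)
      then show ?thesis using n G_a0[OF i, of n] G_Suc[of m] by blast
    qed
  qed
  have "ap i ` span monomials \<subseteq> orthogonal_comp {\<phi>}"
    using ap_orth
    by (intro linear_endo_on_maps_span[OF ap[OF i] V subspace_orthogonal_comp monomials_subset]) blast
  moreover have "a0 i ` span monomials \<subseteq> orthogonal_comp {\<phi>}"
    using a0_orth
    by (intro linear_endo_on_maps_span[OF a0[OF i] V subspace_orthogonal_comp monomials_subset]) blast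
  ultimately have "inner \<phi> (ap i v) = 0" "inner \<phi> (a0 i v) = 0"
    using v by (auto simp: orthogonal_comp_def orthogonal_def)
  then show ?thesis
    by (simp add: field_def inner_add_left inner_add_right inner_commute[of _ \<phi>])
qed

lemma field_word_in_span:
  assumes "set w \<subseteq> I"
  shows "field_word w \<in> span monomials"
  using assms
proof (induction w)
  case Nil
  show ?case by (simp add: span_base monomials.vacuum)
next
  case (Cons i w)
  then show ?case
    by (simp add: field_def span_add span_monomials_am span_monomials_a0 span_monomials_ap)
qed

lemma am_field:
  assumes "i \<in> I" "j \<in> I" "v \<in> span monomials"
  shows "am i (field j v) = field j (am i v) + c i j *\<^sub>R v"
proof -
  have v: "v \<in> V" using assms(3) span_monomials_subset by blast
  note [intro] = linear_endo_on_closed[OF am] linear_endo_on_closed[OF a0] linear_endo_on_closed[OF ap]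
    subspace_add[OF V]
  have "am i (field j v) = am i (am j v) + am i (a0 j v) + am i (ap j v)"
    using assms(1,2) v unfolding field_def
    by (subst linear_endo_on_add[OF am] | blast)+
  then show ?thesis
    by (simp add: field_def am_commute[OF assms] am_a0_eq am_ap_eq assms(1,2) v)
qed

lemma field_linear: "i \<in> I \<Longrightarrow> linear_endo_on V (field i)"
  unfolding linear_endo_on_def field_def
  using linear_endo_onD[OF am] linear_endo_onD[OF a0] linear_endo_onD[OF ap] subspace_add[OF V]
  by (auto simp: algebra_simps)

text \<open>Moving the annihilation operator through the fields one at a time produces one term for each
  field passed. The factors are labelled by distinct positions \<open>xs\<close>, so that \<open>remove1 x\<close> deletes
  precisely the factor that was passed, even when its field index \<open>\<sigma> x\<close> occurs several times.\<close>

lemma am_field_word: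
  assumes i: "i \<in> I" and "distinct xs" "\<sigma> ` set xs \<subseteq> I"
  shows "am i (field_word (map \<sigma> xs)) =
    (\<Sum>x\<in>set xs. c i (\<sigma> x) *\<^sub>R field_word (map \<sigma> (remove1 x xs)))"
  using assms(2,3)
proof (induction xs)
  case Nil
  show ?case by (simp add: am_vacuum[OF i])
next
  case (Cons y xs)
  have y: "\<sigma> y \<in> I" and xs: "\<sigma> ` set xs \<subseteq> I" using Cons.prems by auto
  have inV: "field_word (map \<sigma> (remove1 x xs)) \<in> V" for x
    using field_word_in_span[of "map \<sigma> (remove1 x xs)"] span_monomials_subset xs
      set_remove1_subset[of x xs] by (force simp: image_subset_iff)
  have "field (\<sigma> y) (am i (field_word (map \<sigma> xs))) =
      (\<Sum>x\<in>set xs. field (\<sigma> y) (c i (\<sigma> x) *\<^sub>R field_word (map \<sigma> (remove1 x xs))))"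
    using Cons xs
    by (simp add: linear_endo_on_sum[OF field_linear[OF y] V] subspace_scale[OF V] inV)
  also have "\<dots> = (\<Sum>x\<in>set xs. c i (\<sigma> x) *\<^sub>R field_word (map \<sigma> (remove1 x (y # xs))))"
    using Cons.prems(1)
    by (intro sum.cong) (auto simp: linear_endo_on_scale[OF field_linear[OF y] inV])
  finally show ?case
    using Cons.prems(1) am_field[OF i y field_word_in_span[of "map \<sigma> xs"]] xs
    by (simp add: add.commute)
qed

lemma vacuum_moment_recursion:
  assumes A: "finite A" "A \<noteq> {}" and \<sigma>: "\<sigma> ` A \<subseteq> I"
  defines "moment \<equiv> \<lambda>B. inner (field_word (map \<sigma> (sorted_list_of_set B))) \<phi>"
  shows "moment A = (\<Sum>j\<in>A - {Min A}. c (\<sigma> (Min A)) (\<sigma> j) * moment (A - {Min A, j}))"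
proof -
  define B where "B = A - {Min A}"
  have B: "finite B" "\<sigma> ` B \<subseteq> I" using A \<sigma> by (auto simp: B_def)
  have m: "\<sigma> (Min A) \<in> I" using Min_in[OF A] \<sigma> by blast
  have A_eq: "sorted_list_of_set A = Min A # sorted_list_of_set B"
    unfolding B_def by (rule sorted_list_of_set_nonempty[OF A])
  have "moment A = inner (am (\<sigma> (Min A)) (field_word (map \<sigma> (sorted_list_of_set B)))) \<phi>"
    using B by (simp add: moment_def A_eq inner_field_vacuum[OF m field_word_in_span])
  also have "\<dots> = (\<Sum>j\<in>B. c (\<sigma> (Min A)) (\<sigma> j) * moment (B - {j}))"
    using B by (simp add: am_field_word[OF m] inner_sum_left moment_def sorted_list_of_set_remove)
  finally show ?thesis
    unfolding B_def by (simp only: Diff_insert2[of A "Min A", symmetric])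
qed

end

section \<open>Complete Feynman diagrams\<close>

text \<open>Since every block has two elements and is listed in increasing order, a block determines its
  ordered pair. A diagram is therefore the same as a set of increasing pairs in which every
  point of \<open>A\<close> lies on exactly one pair, a form in which pairs are easily added and removed.\<close>

lemma complete_feynman_iff:
  "\<gamma> \<in> complete_feynman A \<longleftrightarrow>
    (\<forall>(i, j)\<in>\<gamma>. i < j \<and> i \<in> A \<and> j \<in> A) \<and> (\<forall>x\<in>A. \<exists>!p. p \<in> \<gamma> \<and> (x = fst p \<or> x = snd p))"
  (is "_ \<longleftrightarrow> ?pairs \<and> ?cover")
proof
  assume *: "\<gamma> \<in> complete_feynman A"
  then have lt: "\<And>i j. (i, j) \<in> \<gamma> \<Longrightarrow> i < j"
    and part: "partition_on A ((\<lambda>(i, j). {i, j}) ` \<gamma>)"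
    unfolding complete_feynman_def by auto
  have pairs: ?pairs
    using lt partition_onD1[OF part] by auto
  moreover have ?cover
  proof
    fix x assume "x \<in> A"
    then obtain i j where ij: "(i, j) \<in> \<gamma>" "x = i \<or> x = j"
      using partition_onD1[OF part] by auto
    show "\<exists>!p. p \<in> \<gamma> \<and> (x = fst p \<or> x = snd p)"
    proof (rule ex1I[of _ "(i, j)"])
      fix p assume p: "p \<in> \<gamma> \<and> (x = fst p \<or> x = snd p)"
      obtain k l where kl: "p = (k, l)" by (cases p)
      have blocks: "{i, j} \<in> (\<lambda>(i, j). {i, j}) ` \<gamma>" "{k, l} \<in> (\<lambda>(i, j). {i, j}) ` \<gamma>"
        using ij p kl by force+
      have "{i, j} \<inter> {k, l} \<noteq> {}" using ij p kl by auto
      then have "{i, j} = {k, l}"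
        using disjointD[OF partition_onD2[OF part] blocks] by metis
      then show "p = (i, j)"
        using lt[of i j] lt[of k l] ij p kl by (auto simp: doubleton_eq_iff)
    qed (use ij in auto)
  qed
  ultimately show "?pairs \<and> ?cover" by blast
next
  assume *: "?pairs \<and> ?cover"
  have "partition_on A ((\<lambda>(i, j). {i, j}) ` \<gamma>)"
  proof (rule partition_onI)
    show "\<Union> ((\<lambda>(i, j). {i, j}) ` \<gamma>) = A"
    proof
      show "A \<subseteq> \<Union> ((\<lambda>(i, j). {i, j}) ` \<gamma>)"
      proof
        fix x assume "x \<in> A"
        then obtain p where "p \<in> \<gamma>" "x = fst p \<or> x = snd p" using * by blast
        then show "x \<in> \<Union> ((\<lambda>(i, j). {i, j}) ` \<gamma>)" by (cases p) auto
      qed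
    qed (use * in auto)
    fix P Q assume PQ: "P \<in> (\<lambda>(i, j). {i, j}) ` \<gamma>" "Q \<in> (\<lambda>(i, j). {i, j}) ` \<gamma>" "P \<noteq> Q"
    then obtain p q where pq: "p \<in> \<gamma>" "q \<in> \<gamma>" "P = {fst p, snd p}" "Q = {fst q, snd q}"
      unfolding image_iff case_prod_beta by blast
    show "disjnt P Q"
    proof (rule ccontr)
      assume "\<not> disjnt P Q"
      then obtain x where x: "x \<in> P" "x \<in> Q" by (auto simp: disjnt_def)
      then have "x \<in> A" using pq * by auto
      then have "p = q" using x pq * by blast
      then show False using pq PQ by simp
    qed
  qed auto
  then show "\<gamma> \<in> complete_feynman A"
    unfolding complete_feynman_def using * by auto
qed

lemma complete_feynman_subset: "\<gamma> \<in> complete_feynman A \<Longrightarrow> \<gamma> \<subseteq> A \<times> A"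
  by (auto simp: complete_feynman_iff)

lemma finite_complete_feynman: "finite A \<Longrightarrow> finite (complete_feynman A)"
  by (rule finite_subset[of _ "Pow (A \<times> A)"]) (auto dest: complete_feynman_subset)

lemma insert_complete_feynman:
  assumes A: "finite A" and j: "j \<in> A - {Min A}" and \<gamma>: "\<gamma> \<in> complete_feynman (A - {Min A, j})"
  shows "insert (Min A, j) \<gamma> \<in> complete_feynman A"
  unfolding complete_feynman_iff
proof (intro conjI ballI)
  have m: "Min A \<in> A" "Min A < j" using A j by (auto intro!: order.not_eq_order_implies_strict Min_in)
  fix p assume "p \<in> insert (Min A, j) \<gamma>"
  then show "case p of (k, l) \<Rightarrow> k < l \<and> k \<in> A \<and> l \<in> A"
    using m j \<gamma> by (auto simp: complete_feynman_iff)
next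
  fix x assume x: "x \<in> A"
  have pairs: "\<And>p. p \<in> \<gamma> \<Longrightarrow> fst p \<in> A - {Min A, j} \<and> snd p \<in> A - {Min A, j}"
    using complete_feynman_subset[OF \<gamma>] by auto
  show "\<exists>!p. p \<in> insert (Min A, j) \<gamma> \<and> (x = fst p \<or> x = snd p)"
  proof (cases "x = Min A \<or> x = j")
    case True
    then have "\<not> (x = fst p \<or> x = snd p)" if "p \<in> \<gamma>" for p
      using pairs[OF that] by auto
    then show ?thesis using True by (intro ex1I[of _ "(Min A, j)"]) auto
  next
    case False
    then have "\<exists>!p. p \<in> \<gamma> \<and> (x = fst p \<or> x = snd p)"
      using x \<gamma> unfolding complete_feynman_iff by blast
    moreover have "p \<in> insert (Min A, j) \<gamma> \<and> (x = fst p \<or> x = snd p) \<longleftrightarrow>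
        p \<in> \<gamma> \<and> (x = fst p \<or> x = snd p)" for p
      using False by auto
    ultimately show ?thesis by (simp only:)
  qed
qed

text \<open>The pair through \<open>Min A\<close> is increasing, so \<open>Min A\<close> must be its first entry.\<close>

lemma complete_feynman_remove:
  assumes A: "finite A" "A \<noteq> {}" and \<gamma>: "\<gamma> \<in> complete_feynman A"
  obtains j \<delta> where "j \<in> A - {Min A}" "\<delta> \<in> complete_feynman (A - {Min A, j})"
    "\<gamma> = insert (Min A, j) \<delta>"
proof -
  have pairs: "k < l \<and> k \<in> A \<and> l \<in> A" if "(k, l) \<in> \<gamma>" for k l
    using \<gamma> that by (auto simp: complete_feynman_iff)
  have cover: "\<exists>!p. p \<in> \<gamma> \<and> (x = fst p \<or> x = snd p)" if "x \<in> A" for x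
    using \<gamma> that unfolding complete_feynman_iff by blast
  obtain p where p: "p \<in> \<gamma>" "Min A = fst p \<or> Min A = snd p"
    using cover[OF Min_in[OF A]] by blast
  obtain k l where "p = (k, l)" by (cases p)
  with p have kl: "(k, l) \<in> \<gamma>" "Min A = k \<or> Min A = l" by simp_all
  have "Min A = k"
    using kl pairs[OF kl(1)] Min_le[OF A(1), of k] by auto
  then have l: "(Min A, l) \<in> \<gamma>" using kl by simp
  define \<delta> where "\<delta> = \<gamma> - {(Min A, l)}"
  have ne: "x \<noteq> Min A \<and> x \<noteq> l" if "p \<in> \<delta>" "x = fst p \<or> x = snd p" for p x
  proof (rule ccontr)
    assume "\<not> (x \<noteq> Min A \<and> x \<noteq> l)"
    then have "(Min A, l) \<in> \<gamma> \<and> (x = fst (Min A, l) \<or> x = snd (Min A, l))" "x \<in> A"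
      using l pairs[OF l] by auto
    moreover have "p \<in> \<gamma>" using that by (simp add: \<delta>_def)
    ultimately have "p = (Min A, l)" using cover[of x] that(2) by blast
    then show False using that by (simp add: \<delta>_def)
  qed
  have "\<delta> \<in> complete_feynman (A - {Min A, l})"
    unfolding complete_feynman_iff
  proof (intro conjI ballI)
    fix p assume p: "p \<in> \<delta>"
    obtain a b where ab: "p = (a, b)" by (cases p)
    then have "(a, b) \<in> \<gamma>" "a \<noteq> Min A \<and> a \<noteq> l" "b \<noteq> Min A \<and> b \<noteq> l"
      using p ne[OF p, of a] ne[OF p, of b] by (simp_all add: \<delta>_def)
    then show "case p of (k, l') \<Rightarrow> k < l' \<and> k \<in> A - {Min A, l} \<and> l' \<in> A - {Min A, l}"
      using pairs[of a b] ab by simp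
  next
    fix x assume x: "x \<in> A - {Min A, l}"
    then have "p \<in> \<delta> \<and> (x = fst p \<or> x = snd p) \<longleftrightarrow> p \<in> \<gamma> \<and> (x = fst p \<or> x = snd p)" for p
      by (auto simp: \<delta>_def)
    then show "\<exists>!p. p \<in> \<delta> \<and> (x = fst p \<or> x = snd p)"
      using cover[of x] x by simp
  qed
  moreover have "l \<in> A - {Min A}" using pairs[OF l] by auto
  moreover have "\<gamma> = insert (Min A, l) \<delta>" using l by (auto simp: \<delta>_def)
  ultimately show thesis using that by blast
qed

definition feynman_sum :: "(nat \<Rightarrow> nat \<Rightarrow> real) \<Rightarrow> (nat \<Rightarrow> nat) \<Rightarrow> nat set \<Rightarrow> real" where
  "feynman_sum c \<sigma> A = (\<Sum>\<gamma>\<in>complete_feynman A. feynman_weight c \<sigma> \<gamma>)"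

lemma feynman_sum_empty: "feynman_sum c \<sigma> {} = 1"
proof -
  have "complete_feynman {} = {{}}"
    unfolding complete_feynman_iff set_eq_iff by auto
  then show ?thesis by (simp add: feynman_sum_def feynman_weight_def)
qed

text \<open>A diagram on \<open>A\<close> amounts to the choice of a partner \<open>j\<close> for \<open>Min A\<close> and a diagram on the
  remaining points. The weight is multiplicative along this bijection.\<close>

lemma feynman_sum_recursion:
  assumes A: "finite A" "A \<noteq> {}"
  shows "feynman_sum c \<sigma> A =
    (\<Sum>j\<in>A - {Min A}. c (\<sigma> (Min A)) (\<sigma> j) * feynman_sum c \<sigma> (A - {Min A, j}))"
proof -
  define D where "D j = complete_feynman (A - {Min A, j})" for j
  have notin: "(Min A, k) \<notin> \<delta>" if "\<delta> \<in> D j" for \<delta> j k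
    using complete_feynman_subset[of \<delta> "A - {Min A, j}"] that by (auto simp: D_def)
  have fin: "finite \<delta>" if "\<delta> \<in> D j" for \<delta> j
    by (rule finite_subset[OF complete_feynman_subset[of \<delta> "A - {Min A, j}"]])
      (use that A(1) in \<open>simp_all add: D_def\<close>)
  have bij: "bij_betw (\<lambda>(j, \<delta>). insert (Min A, j) \<delta>) (SIGMA j:A - {Min A}. D j) (complete_feynman A)"
    unfolding bij_betw_def
  proof
    show "inj_on (\<lambda>(j, \<delta>). insert (Min A, j) \<delta>) (SIGMA j:A - {Min A}. D j)"
    proof (rule inj_onI)
      fix p q
      assume p: "p \<in> (SIGMA j:A - {Min A}. D j)" and q: "q \<in> (SIGMA j:A - {Min A}. D j)"
        and eq: "(case p of (j, \<delta>) \<Rightarrow> insert (Min A, j) \<delta>) = (case q of (j, \<delta>) \<Rightarrow> insert (Min A, j) \<delta>)"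
      obtain j \<delta> k \<epsilon> where pq: "p = (j, \<delta>)" "q = (k, \<epsilon>)" by (cases p, cases q)
      with p q eq have D: "\<delta> \<in> D j" "\<epsilon> \<in> D k" "insert (Min A, j) \<delta> = insert (Min A, k) \<epsilon>"
        by simp_all
      then have "j = k" using notin[OF D(2), of j] by blast
      moreover have "\<delta> = \<epsilon>"
        using D(3) notin[OF D(1), of k] notin[OF D(2), of k] insert_ident unfolding \<open>j = k\<close> by metis
      ultimately show "p = q" by (simp add: pq)
    qed
    show "(\<lambda>(j, \<delta>). insert (Min A, j) \<delta>) ` (SIGMA j:A - {Min A}. D j) = complete_feynman A"
    proof
      show "complete_feynman A \<subseteq> (\<lambda>(j, \<delta>). insert (Min A, j) \<delta>) ` (SIGMA j:A - {Min A}. D j)"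
      proof
        fix \<gamma> assume "\<gamma> \<in> complete_feynman A"
        then obtain j \<delta> where "j \<in> A - {Min A}" "\<delta> \<in> D j" "\<gamma> = insert (Min A, j) \<delta>"
          unfolding D_def using complete_feynman_remove[OF A] by metis
        then show "\<gamma> \<in> (\<lambda>(j, \<delta>). insert (Min A, j) \<delta>) ` (SIGMA j:A - {Min A}. D j)"
          by (intro image_eqI[of _ _ "(j, \<delta>)"]) auto
      qed
    qed (use insert_complete_feynman[OF A(1)] in \<open>auto simp: D_def\<close>)
  qed
  have "feynman_sum c \<sigma> A =
      (\<Sum>(j, \<delta>)\<in>(SIGMA j:A - {Min A}. D j). feynman_weight c \<sigma> (insert (Min A, j) \<delta>))"
    unfolding feynman_sum_def sum.reindex_bij_betw[OF bij, symmetric]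
    by (simp add: case_prod_beta)
  also have "\<dots> = (\<Sum>j\<in>A - {Min A}. \<Sum>\<delta>\<in>D j. feynman_weight c \<sigma> (insert (Min A, j) \<delta>))"
    using A(1) by (subst sum.Sigma) (auto simp: D_def finite_complete_feynman)
  also have "\<dots> = (\<Sum>j\<in>A - {Min A}. \<Sum>\<delta>\<in>D j. c (\<sigma> (Min A)) (\<sigma> j) * feynman_weight c \<sigma> \<delta>)"
    by (intro sum.cong refl) (simp add: feynman_weight_def fin notin)
  finally show ?thesis
    by (simp add: feynman_sum_def D_def sum_distrib_left)
qed

text \<open>Deleting pairs keeps the cardinality odd, and the recursion ends at a single point, which has
  no possible partner.\<close>

lemma feynman_sum_odd:
  assumes "finite A" "odd (card A)"
  shows "feynman_sum c \<sigma> A = 0"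
  using assms
proof (induction A rule: finite_psubset_induct)
  case (psubset A)
  have ne: "A \<noteq> {}" using psubset.prems by auto
  have "feynman_sum c \<sigma> (A - {Min A, j}) = 0" if j: "j \<in> A - {Min A}" for j
  proof (rule psubset.IH)
    show "A - {Min A, j} \<subset> A" using j by blast
    have "card (A - {Min A, j}) = card A - 2" "2 \<le> card A"
      using j Min_in[OF psubset.hyps ne] psubset.hyps
        card_Diff_subset[of "{Min A, j}" A] card_mono[of A "{Min A, j}"] by auto
    then show "odd (card (A - {Min A, j}))" using psubset.prems by simp
  qed
  then show ?case by (simp add: feynman_sum_recursion[OF psubset.hyps ne])
qed

lemma (in fock_operators) vacuum_moment_eq_feynman_sum:
  assumes "norm \<phi> = 1" and "finite A" and "\<sigma> ` A \<subseteq> I"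
  shows "inner (field_word (map \<sigma> (sorted_list_of_set A))) \<phi> = feynman_sum c \<sigma> A"
  using assms(2,3)
proof (induction A rule: finite_psubset_induct)
  case (psubset A)
  show ?case
  proof (cases "A = {}")
    case True
    then show ?thesis using assms(1) by (simp add: feynman_sum_empty dot_square_norm)
  next
    case False
    have "inner (field_word (map \<sigma> (sorted_list_of_set (A - {Min A, j})))) \<phi> =
        feynman_sum c \<sigma> (A - {Min A, j})" if "j \<in> A - {Min A}" for j
      by (rule psubset.IH) (use that psubset.prems in blast)+
    then show ?thesis
      unfolding vacuum_moment_recursion[OF psubset.hyps False psubset.prems]
        feynman_sum_recursion[OF psubset.hyps False]
      by (intro sum.cong) simp_all
  qed
qed

section \<open>The orbit of the vacuum vector\<close>

lemma vacuum_in_orbit: "\<phi> \<in> vacuum_orbit d X \<phi>"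
  unfolding vacuum_orbit_def using gen_algebra.one by (force simp: pop_id_def)

lemma subspace_vacuum_orbit:
  assumes "probability_space d X \<phi>"
  shows "subspace (vacuum_orbit d X \<phi>)"
proof (rule subspaceI)
  have dom: "\<exists>v. g \<phi> = Some v" if "g \<in> gen_algebra d X" for g
    using assms that unfolding probability_space_def by blast
  show scale: "r *\<^sub>R x \<in> vacuum_orbit d X \<phi>" if x: "x \<in> vacuum_orbit d X \<phi>" for r x
  proof -
    obtain g where g: "g \<in> gen_algebra d X" "x = the (g \<phi>)"
      using x by (auto simp: vacuum_orbit_def)
    then have "r *\<^sub>R x = the (pop_scale r g \<phi>)"
      using dom[OF g(1)] by (auto simp: pop_scale_def)
    then show ?thesis
      unfolding vacuum_orbit_def using gen_algebra.scale[OF g(1)] by blast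
  qed
  show "x + y \<in> vacuum_orbit d X \<phi>"
    if xy: "x \<in> vacuum_orbit d X \<phi>" "y \<in> vacuum_orbit d X \<phi>" for x y
  proof -
    obtain g h where g: "g \<in> gen_algebra d X" "x = the (g \<phi>)"
      and h: "h \<in> gen_algebra d X" "y = the (h \<phi>)"
      using xy by (auto simp: vacuum_orbit_def)
    then have "x + y = the (pop_add g h \<phi>)"
      using dom[OF g(1)] dom[OF h(1)] by (auto simp: pop_add_def)
    then show ?thesis
      unfolding vacuum_orbit_def using gen_algebra.add[OF g(1) h(1)] by blast
  qed
  from scale[OF vacuum_in_orbit, of 0] show "0 \<in> vacuum_orbit d X \<phi>" by simp
qed

lemma vacuum_in_F_space: "\<phi> \<in> F_space d X \<phi> n"
proof -
  have "Poly_Mapping.single [] 1 \<in> ncpolys d n"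
    by (simp add: ncpolys_def)
  moreover have "the (ncpoly_pop X (Poly_Mapping.single [] 1) \<phi>) = \<phi>"
    by (simp add: ncpoly_pop_def pop_id_def dom_def)
  ultimately show ?thesis unfolding F_space_def by force
qed

lemma F_space_0_subset: "F_space d X \<phi> 0 \<subseteq> span {\<phi>}"
proof
  fix v assume "v \<in> F_space d X \<phi> 0"
  then obtain p where p: "\<forall>w\<in>Poly_Mapping.keys p. w = []" "v = the (ncpoly_pop X p \<phi>)"
    by (auto simp: F_space_def ncpolys_def)
  have "ncpoly_pop X p \<phi> = Some (\<Sum>w\<in>Poly_Mapping.keys p. Poly_Mapping.lookup p w *\<^sub>R \<phi>)"
    using p(1) by (auto simp: ncpoly_pop_def pop_id_def dom_def intro!: sum.cong)
  then show "v \<in> span {\<phi>}"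
    using p(2) by (simp add: span_sum span_scale span_base)
qed

lemma G_space_subset_orthogonal_comp:
  "G_space d X \<phi> (int (Suc n)) \<subseteq> orthogonal_comp {\<phi>}"
  using vacuum_in_F_space[of \<phi> d X n]
  by (auto simp: G_space_def orthogonal_comp_def)

text \<open>The two vanishing conditions on the vacuum come from degrees: \<open>a\<^sup>-(i) \<phi>\<close> lies in
  \<open>G\<^sub>-\<^sub>1 = {0}\<close>, and \<open>a\<^sup>0(i) \<phi>\<close> is a multiple of \<open>\<phi>\<close> whose factor is \<open>E[X\<^sub>i] = 0\<close>, the creation part
  of \<open>X\<^sub>i \<phi>\<close> being orthogonal to \<open>\<phi>\<close>.\<close>

lemma fock_operators_vacuum_orbit:
  assumes prob: "probability_space d X \<phi>"
    and ops: "ann_pres_cre_operators d X \<phi> am a0 ap"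
    and am_ap: "\<And>i j v. i \<in> {1..d} \<Longrightarrow> j \<in> {1..d} \<Longrightarrow> v \<in> vacuum_orbit d X \<phi> \<Longrightarrow>
           commutator (am i) (ap j) v = c i j *\<^sub>R v"
    and am_a0: "\<And>i j v. i \<in> {1..d} \<Longrightarrow> j \<in> {1..d} \<Longrightarrow> v \<in> vacuum_orbit d X \<phi> \<Longrightarrow>
           commutator (am i) (a0 j) v = 0"
    and centred: "\<And>i. i \<in> {1..d} \<Longrightarrow> expectation \<phi> (X i) = 0"
  shows "fock_operators {1..d} (vacuum_orbit d X \<phi>) \<phi> c am a0 ap (\<lambda>n. G_space d X \<phi> (int n))"
proof -
  have linear: "linear_endo_on (vacuum_orbit d X \<phi>) (am i)"
    "linear_endo_on (vacuum_orbit d X \<phi>) (a0 i)" "linear_endo_on (vacuum_orbit d X \<phi>) (ap i)"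
    and X: "X i \<phi> = Some (am i \<phi> + a0 i \<phi> + ap i \<phi>)"
    and G: "am i ` G_space d X \<phi> (int n) \<subseteq> G_space d X \<phi> (int n - 1)"
      "a0 i ` G_space d X \<phi> (int n) \<subseteq> G_space d X \<phi> (int n)"
      "ap i ` G_space d X \<phi> (int n) \<subseteq> G_space d X \<phi> (int n + 1)"
    if "i \<in> {1..d}" for i n
    using ops that vacuum_in_orbit[of \<phi> d X] unfolding ann_pres_cre_operators_def by blast+
  have G0: "\<phi> \<in> G_space d X \<phi> (int 0)" "G_space d X \<phi> (int 0) \<subseteq> span {\<phi>}"
    using vacuum_in_F_space[of \<phi> d X 0] F_space_0_subset[of d X \<phi>] by (simp_all add: G_space_def)
  have ap_G: "ap i ` G_space d X \<phi> (int n) \<subseteq> G_space d X \<phi> (int (Suc n))" if "i \<in> {1..d}" for i n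
    using G(3)[OF that, of n] by (simp add: add.commute)
  have am_vacuum: "am i \<phi> = 0" if "i \<in> {1..d}" for i
    using G(1)[OF that, of 0] G0(1) by (auto simp: G_space_def)
  have a0_vacuum: "a0 i \<phi> = 0" if i: "i \<in> {1..d}" for i
  proof -
    have "a0 i \<phi> \<in> span {\<phi>}" using G(2)[OF i, of 0] G0 by blast
    then obtain r where r: "a0 i \<phi> = r *\<^sub>R \<phi>" by (auto simp: span_singleton)
    have "ap i \<phi> \<in> orthogonal_comp {\<phi>}"
      using ap_G[OF i, of 0] G0(1) G_space_subset_orthogonal_comp[of d X \<phi> 0] by blast
    then have "inner (ap i \<phi>) \<phi> = 0"
      by (simp add: orthogonal_comp_def orthogonal_def inner_commute)
    moreover have "inner \<phi> \<phi> = 1"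
      using prob by (simp add: probability_space_def dot_square_norm)
    ultimately have "r = 0"
      using centred[OF i] by (simp add: expectation_def X[OF i] am_vacuum[OF i] r inner_add_left)
    then show ?thesis by (simp add: r)
  qed
  show ?thesis
    using subspace_vacuum_orbit[OF prob] vacuum_in_orbit linear am_ap am_a0 am_vacuum a0_vacuum
      G0 G_space_subset_orthogonal_comp G(2) ap_G
    by (intro fock_operators.intro)
qed

theorem corollary4p8:
  fixes d :: nat
    and c :: "nat \<Rightarrow> nat \<Rightarrow> real"
    and X :: "nat \<Rightarrow> 'h::{real_inner, complete_space} pop"
    and \<phi> :: 'h
    and am a0 ap :: "nat \<Rightarrow> 'h \<Rightarrow> 'h"
  assumes "d \<ge> 1"
    and "probability_space d X \<phi>"
    and "ann_pres_cre_operators d X \<phi> am a0 ap"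
    and "\<And>i j v. i \<in> {1..d} \<Longrightarrow> j \<in> {1..d} \<Longrightarrow> v \<in> vacuum_orbit d X \<phi> \<Longrightarrow>
           commutator (am i) (ap j) v = c i j *\<^sub>R v"
    and "\<And>i j v. i \<in> {1..d} \<Longrightarrow> j \<in> {1..d} \<Longrightarrow> v \<in> vacuum_orbit d X \<phi> \<Longrightarrow>
           commutator (am i) (a0 j) v = 0"
    and "\<And>i. i \<in> {1..d} \<Longrightarrow> expectation \<phi> (X i) = 0"
  shows "(\<forall>(n::nat) \<sigma>. \<sigma> \<in> {1..2*n} \<rightarrow> {1..d} \<longrightarrow>
            expectation \<phi> (word_pop X (map \<sigma> [1..<2*n+1])) =
            (\<Sum>\<gamma>\<in>complete_feynman {1..2*n}. feynman_weight c \<sigma> \<gamma>)) \<and>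
         (\<forall>(n::nat) \<sigma>. \<sigma> \<in> {1..2*n+1} \<rightarrow> {1..d} \<longrightarrow>
            expectation \<phi> (word_pop X (map \<sigma> [1..<2*n+2])) = 0)"
proof -
  interpret fock_operators "{1..d}" "vacuum_orbit d X \<phi>" \<phi> c am a0 ap
    "\<lambda>n. G_space d X \<phi> (int n)"
    using assms(2-6) by (rule fock_operators_vacuum_orbit)
  have norm: "norm \<phi> = 1" using assms(2) by (simp add: probability_space_def)
  \<comment> \<open>The products of the partial operators are defined at the vacuum and agree there with the total fields.\<close>
  have word: "word_pop X w \<phi> = Some (field_word w)" if "set w \<subseteq> {1..d}" for w
    using that
  proof (induction w)
    case (Cons i w)
    then have "field_word w \<in> vacuum_orbit d X \<phi>"
      using field_word_in_span[of w] span_monomials_subset by auto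
    moreover have "i \<in> {1..d}" using Cons.prems by simp
    ultimately have "X i (field_word w) = Some (field i (field_word w))"
      using assms(3) unfolding ann_pres_cre_operators_def field_def by blast
    then show ?case using Cons by (simp add: map_comp_def)
  qed (simp add: pop_id_def)
  have moment: "expectation \<phi> (word_pop X (map \<sigma> [1..<Suc m])) = feynman_sum c \<sigma> {1..m}"
    if \<sigma>: "\<sigma> \<in> {1..m} \<rightarrow> {1..d}" for \<sigma> m
  proof -
    have "sorted_list_of_set {1..m} = [1..<Suc m]"
      using sorted_list_of_set_range[of 1 "Suc m"] by (simp add: atLeastLessThanSuc_atLeastAtMost)
    moreover have "set (map \<sigma> [1..<Suc m]) \<subseteq> {1..d}" using \<sigma> by fastforce
    ultimately show ?thesis
      using vacuum_moment_eq_feynman_sum[OF norm, of "{1..m}" \<sigma>] \<sigma>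
      by (simp del: upt_Suc add: expectation_def word image_subset_iff Pi_iff)
  qed
  show ?thesis
  proof (intro conjI allI impI)
    fix n :: nat and \<sigma> assume "\<sigma> \<in> {1..2*n} \<rightarrow> {1..d}"
    then show "expectation \<phi> (word_pop X (map \<sigma> [1..<2*n+1])) =
        (\<Sum>\<gamma>\<in>complete_feynman {1..2*n}. feynman_weight c \<sigma> \<gamma>)"
      using moment[of \<sigma> "2*n"] unfolding feynman_sum_def by simp
  next
    fix n :: nat and \<sigma> assume "\<sigma> \<in> {1..2*n+1} \<rightarrow> {1..d}"
    then show "expectation \<phi> (word_pop X (map \<sigma> [1..<2*n+2])) = 0"
      using moment[of \<sigma> "2*n+1"] feynman_sum_odd[of "{1..2*n+1}" c \<sigma>] by simp
  qed
qed

end
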